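(* Let $G$ be a cycle of length $L>0$, regarded as a metric graph, and let $w\ge 1$ be an integer. The minimum of $\mathrm{diam}(G')$ over all metric graphs $G'$ obtained from $G$ by the fusion of $w+1$ distinct points of $G$ (that is, identifying these $w+1$ points to a single point) is equal to $L/(w+1)$.
   Context: A metric graph is a finite edge-weighted graph regarded as a metric space in which all points in the interior of each edge are included and each edge is locally isometric to an interval whose length is the edge weight; $\mathrm{diam}(G)=\max_{x,y\in G} d_G(x,y)$ over all points of $G$, where $d_G(x,y)$ is the minimum length of a path from $x$ to $y$. The points to be fused may be arbitrary points of the cycle. *)

theory Defs
  imports Complex_Main
begin

text \<open>Finite edge-weighted graphs, loops and parallel edges allowed. Edges are undirected: the
  order of the two ends only fixes which end of an edge has coordinate \<open>0\<close>.\<close>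

record ('v, 'e) wgraph =
  verts :: "'v set"
  edges :: "'e set"
  end0 :: "'e \<Rightarrow> 'v"
  end1 :: "'e \<Rightarrow> 'v"
  len :: "'e \<Rightarrow> real"

definition wf_wgraph :: "('v, 'e) wgraph \<Rightarrow> bool" where
  "wf_wgraph G \<longleftrightarrow> finite (verts G) \<and> finite (edges G) \<and>
     (\<forall>e\<in>edges G. end0 G e \<in> verts G \<and> end1 G e \<in> verts G \<and> 0 < len G e)"

text \<open>The points of the associated metric graph: \<open>Interior e t\<close> is the point in the open edge \<open>e\<close>
  at distance \<open>t\<close> (measured along \<open>e\<close>) from \<open>end0 G e\<close>.\<close>

datatype ('v, 'e) point = Vertex 'v | Interior 'e real

definition points :: "('v, 'e) wgraph \<Rightarrow> ('v, 'e) point set" where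
  "points G = Vertex ` verts G \<union> {Interior e t | e t. e \<in> edges G \<and> 0 < t \<and> t < len G e}"

definition point_at :: "('v, 'e) wgraph \<Rightarrow> 'e \<Rightarrow> real \<Rightarrow> ('v, 'e) point" where
  "point_at G e t =
     (if t = 0 then Vertex (end0 G e)
      else if t = len G e then Vertex (end1 G e)
      else Interior e t)"

text \<open>\<open>path_length G x y d\<close>: some path from \<open>x\<close> to \<open>y\<close>, a concatenation of finitely many segments
  of (closed) edges, has length \<open>d\<close>.\<close>

inductive path_length :: "('v, 'e) wgraph \<Rightarrow> ('v, 'e) point \<Rightarrow> ('v, 'e) point \<Rightarrow> real \<Rightarrow> bool"
  for G where
  trivial: "x \<in> points G \<Longrightarrow> path_length G x x 0"
| segment: "\<lbrakk>e \<in> edges G; 0 \<le> s; s \<le> len G e; 0 \<le> t; t \<le> len G e;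
    path_length G (point_at G e t) y d\<rbrakk>
    \<Longrightarrow> path_length G (point_at G e s) y (\<bar>s - t\<bar> + d)"

text \<open>In a connected finite metric graph the infimum below is a minimum and, by compactness, the
  supremum is a maximum. No meaning is attached to the values for disconnected graphs.\<close>

definition graph_dist :: "('v, 'e) wgraph \<Rightarrow> ('v, 'e) point \<Rightarrow> ('v, 'e) point \<Rightarrow> real" where
  "graph_dist G x y = Inf {d. path_length G x y d}"

definition diam :: "('v, 'e) wgraph \<Rightarrow> real" where
  "diam G = Sup {graph_dist G x y | x y. x \<in> points G \<and> y \<in> points G}"

text \<open>A cycle with \<open>n\<close> vertices; \<open>n = 1\<close> is a loop and \<open>n = 2\<close> a pair of parallel edges.\<close>

definition is_cycle :: "('v, 'e) wgraph \<Rightarrow> bool" where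
  "is_cycle G \<longleftrightarrow> (\<exists>n\<ge>1. \<exists>v e.
     bij_betw v {..<n} (verts G) \<and> bij_betw e {..<n} (edges G) \<and>
     (\<forall>i<n. {end0 G (e i), end1 G (e i)} = {v i, v (Suc i mod n)}))"

definition total_length :: "('v, 'e) wgraph \<Rightarrow> real" where
  "total_length G = (\<Sum>e\<in>edges G. len G e)"

text \<open>Fusion of a finite set \<open>P\<close> of points: first subdivide so that the points of \<open>P\<close> become
  vertices, which does not change the metric graph, then identify these vertices. The edge
  \<open>(e, a, b)\<close> of the subdivision is the part of \<open>e\<close> between the consecutive cut coordinates
  \<open>a < b\<close>.\<close>

definition cuts :: "('v, 'e) wgraph \<Rightarrow> ('v, 'e) point set \<Rightarrow> 'e \<Rightarrow> real set" where
  "cuts G P e = {0, len G e} \<union> {t. Interior e t \<in> P}"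

definition subdivide ::
  "('v, 'e) wgraph \<Rightarrow> ('v, 'e) point set \<Rightarrow> (('v, 'e) point, 'e \<times> real \<times> real) wgraph" where
  "subdivide G P =
     \<lparr>verts = Vertex ` verts G \<union> P,
      edges = {(e, a, b). e \<in> edges G \<and> a \<in> cuts G P e \<and> b \<in> cuts G P e \<and> a < b \<and>
                 (\<forall>c\<in>cuts G P e. \<not> (a < c \<and> c < b))},
      end0 = (\<lambda>(e, a, b). point_at G e a),
      end1 = (\<lambda>(e, a, b). point_at G e b),
      len = (\<lambda>(e, a, b). b - a)\<rparr>"

definition identify_verts :: "('v, 'e) wgraph \<Rightarrow> 'v set \<Rightarrow> ('v set, 'e) wgraph" where
  "identify_verts G S =
     (let q = (\<lambda>v. if v \<in> S then S else {v}) in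
      \<lparr>verts = q ` verts G, edges = edges G,
       end0 = q \<circ> end0 G, end1 = q \<circ> end1 G, len = len G\<rparr>)"

definition fusion ::
  "('v, 'e) wgraph \<Rightarrow> ('v, 'e) point set \<Rightarrow> (('v, 'e) point set, 'e \<times> real \<times> real) wgraph" where
  "fusion G P = identify_verts (subdivide G P) P"

lemma finite_cuts: "finite P \<Longrightarrow> finite (cuts G P e)"
proof -
  assume "finite P"
  then have "finite {t. Interior e t \<in> P}"
    using finite_vimageI[of P "Interior e"] by (simp add: inj_def vimage_def)
  then show ?thesis by (simp add: cuts_def)
qed

lemma wf_wgraph_subdivide:
  assumes "wf_wgraph G" "P \<subseteq> points G" "finite P"
  shows "wf_wgraph (subdivide G P)"
proof -
  have "edges (subdivide G P) \<subseteq> (SIGMA e : edges G. cuts G P e \<times> cuts G P e)"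
    by (auto simp: subdivide_def)
  moreover have "finite (SIGMA e : edges G. cuts G P e \<times> cuts G P e)"
    using assms finite_cuts[OF assms(3)] by (auto simp: wf_wgraph_def)
  ultimately have "finite (edges (subdivide G P))" by (rule finite_subset)
  then show ?thesis
    using assms by (auto simp: wf_wgraph_def subdivide_def cuts_def point_at_def)
qed

lemma wf_wgraph_fusion:
  assumes "wf_wgraph G" "P \<subseteq> points G" "finite P"
  shows "wf_wgraph (fusion G P)"
  using wf_wgraph_subdivide[OF assms]
  by (auto simp: fusion_def identify_verts_def wf_wgraph_def Let_def)

end

theory Submission imports Defs begin

text \<open>
  Fusing \<open>w + 1\<close> points of a cycle gives \<open>w + 1\<close> petals glued at one vertex, whose lengths sum to
  \<open>L\<close>. The midpoints of two petals of lengths \<open>a\<close> and \<open>b\<close> are at distance \<open>(a + b) / 2\<close>, and the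
  two longest petals have \<open>a + b \<ge> 2 L / (w + 1)\<close>. The lower bound on this distance is witnessed by
  a 1-Lipschitz function on the cycle that vanishes at the fused points: a tent of height \<open>a / 2\<close>
  on one petal minus a tent of height \<open>b / 2\<close> on the other. Conversely, for equally spaced points
  every point is within \<open>L / (2 (w + 1))\<close> of the fused vertex.
\<close>

subsection \<open>Paths, distances and diameters\<close>

lemma point_at_in_points:
  assumes "wf_wgraph G" "e \<in> edges G" "0 \<le> t" "t \<le> len G e"
  shows "point_at G e t \<in> points G"
  using assms by (auto simp: point_at_def points_def wf_wgraph_def)

lemma path_length_points:
  assumes "path_length G x y d" "wf_wgraph G"
  shows "x \<in> points G" "y \<in> points G" "0 \<le> d"
  using assms by (induction) (auto intro: point_at_in_points)

lemma path_length_trans: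
  assumes "path_length G x y c" "path_length G y z d"
  shows "path_length G x z (c + d)"
  using assms
proof (induction)
  case (segment e s t y c)
  then show ?case
    using path_length.segment[of e G s t z "c + d"] by (simp add: add.assoc)
qed simp

lemma path_length_segment:
  assumes "wf_wgraph G" "e \<in> edges G" "0 \<le> s" "s \<le> len G e" "0 \<le> t" "t \<le> len G e"
  shows "path_length G (point_at G e s) (point_at G e t) \<bar>s - t\<bar>"
  using path_length.segment[OF assms(2-6) path_length.trivial[OF point_at_in_points]] assms
  by simp

lemma path_length_sym:
  assumes "path_length G x y d" "wf_wgraph G"
  shows "path_length G y x d"
  using assms
proof (induction)
  case (segment e s t y d)
  then have "path_length G y (point_at G e s) (d + \<bar>t - s\<bar>)"
    by (intro path_length_trans[OF _ path_length_segment]) auto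
  then show ?case by (simp add: abs_minus_commute add.commute)
qed (auto intro: path_length.trivial)

text \<open>By the triangle inequality over the segments of the path. All lower bounds on distances
  come from this: \<open>f\<close> is tested on one edge at a time, so no distance has to be
  computed.\<close>

lemma path_length_lipschitz:
  fixes f :: "('v, 'e) point \<Rightarrow> real"
  assumes "path_length G x y d"
    and "\<And>e s t. \<lbrakk>e \<in> edges G; 0 \<le> s; s \<le> len G e; 0 \<le> t; t \<le> len G e\<rbrakk>
      \<Longrightarrow> \<bar>f (point_at G e s) - f (point_at G e t)\<bar> \<le> \<bar>s - t\<bar>"
  shows "\<bar>f x - f y\<bar> \<le> d"
  using assms(1)
proof (induction)
  case (segment e s t y d)
  then show ?case using assms(2)[of e s t] by linarith
qed simp

lemma graph_dist_le:
  assumes "wf_wgraph G" "path_length G x y d"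
  shows "graph_dist G x y \<le> d"
  unfolding graph_dist_def
  using assms by (intro cInf_lower bdd_belowI[of _ 0]) (auto dest: path_length_points)

lemma diam_le:
  assumes "wf_wgraph G" "points G \<noteq> {}"
    and "\<And>x y. \<lbrakk>x \<in> points G; y \<in> points G\<rbrakk> \<Longrightarrow> \<exists>d\<le>B. path_length G x y d"
  shows "diam G \<le> B"
proof -
  have "graph_dist G x y \<le> B" if "x \<in> points G" "y \<in> points G" for x y
    using assms(3)[OF that] graph_dist_le[OF assms(1)] by (meson order_trans)
  moreover obtain z where "z \<in> points G" using assms(2) by blast
  ultimately show ?thesis
    unfolding diam_def by (intro cSup_least) blast+
qed

text \<open>The bound \<open>B\<close> makes both conditionally complete operations meaningful: it
  bounds the set under \<open>Sup\<close> from above, and the path it provides from \<open>x\<close>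
  to \<open>y\<close> shows that the set under \<open>Inf\<close> is nonempty.\<close>

lemma le_diam:
  assumes "wf_wgraph G" "x \<in> points G" "y \<in> points G"
    and "\<And>x y. \<lbrakk>x \<in> points G; y \<in> points G\<rbrakk> \<Longrightarrow> \<exists>d\<le>B. path_length G x y d"
    and "\<And>d. path_length G x y d \<Longrightarrow> r \<le> d"
  shows "r \<le> diam G"
proof -
  have "graph_dist G x y \<le> B" if "x \<in> points G" "y \<in> points G" for x y
    using assms(4)[OF that] graph_dist_le[OF assms(1)] by (meson order_trans)
  then have "graph_dist G x y \<le> diam G"
    unfolding diam_def using assms(2,3) by (intro cSup_upper bdd_aboveI[of _ B]) auto
  moreover have "r \<le> graph_dist G x y"
    unfolding graph_dist_def using assms(4)[OF assms(2,3)] assms(5)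
    by (intro cInf_greatest) auto
  ultimately show ?thesis by simp
qed

text \<open>Splitting at a break point strictly inside leaves fewer break points in each half. It
  reduces claims about long segments to segments inside one edge, both of a fusion (\<open>K\<close>
  the cuts) and of a cycle (\<open>K\<close> the vertex positions).\<close>

lemma interval_chain:
  fixes s t lo hi :: real
  assumes "finite K"
    and base: "\<And>s t. \<lbrakk>lo \<le> s; s \<le> t; t \<le> hi; \<forall>c\<in>K. \<not> (s < c \<and> c < t)\<rbrakk> \<Longrightarrow> R s t"
    and trans: "\<And>s u t. \<lbrakk>R s u; R u t\<rbrakk> \<Longrightarrow> R s t"
    and "lo \<le> s" "s \<le> t" "t \<le> hi"
  shows "R s t"
  using assms(4-6)
proof (induction "card {c \<in> K. s < c \<and> c < t}" arbitrary: s t rule: less_induct)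
  case less
  show ?case
  proof (cases "\<forall>c\<in>K. \<not> (s < c \<and> c < t)")
    case True
    then show ?thesis using base less.prems by blast
  next
    case False
    then obtain c where c: "c \<in> K" "s < c" "c < t" by blast
    have "card {c' \<in> K. s < c' \<and> c' < c} < card {c' \<in> K. s < c' \<and> c' < t}"
      "card {c' \<in> K. c < c' \<and> c' < t} < card {c' \<in> K. s < c' \<and> c' < t}"
      using c \<open>finite K\<close> by (auto intro!: psubset_card_mono)
    then show ?thesis using c less.prems by (intro trans[of s c t] less.hyps) auto
  qed
qed

subsection \<open>The projection of a graph onto its fusion\<close>

text \<open>The quotient map. Since the fusion is built on the subdivided graph, an interior point
  has to be renamed: \<open>a\<close> and \<open>b\<close> are its neighbouring cuts, and its
  coordinate is measured from \<open>a\<close>.\<close>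

definition fuse_proj ::
  "('v, 'e) wgraph \<Rightarrow> ('v, 'e) point set \<Rightarrow> ('v, 'e) point
    \<Rightarrow> (('v, 'e) point set, 'e \<times> real \<times> real) point" where
  "fuse_proj G P x =
     (if x \<in> P then Vertex P
      else case x of
        Vertex v \<Rightarrow> Vertex {x}
      | Interior e t \<Rightarrow>
          (let a = Max {c \<in> cuts G P e. c < t}; b = Min {c \<in> cuts G P e. t < c}
           in Interior (e, a, b) (t - a)))"

locale point_fusion =
  fixes G :: "('v, 'e) wgraph" and P :: "('v, 'e) point set"
  assumes wf: "wf_wgraph G" and P_points: "P \<subseteq> points G" and finite_P: "finite P"
begin

abbreviation "F \<equiv> fusion G P"
abbreviation "\<pi> \<equiv> fuse_proj G P"

lemma wf_F: "wf_wgraph F"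
  using wf_wgraph_fusion[OF wf P_points finite_P] .

lemma cuts_bounds:
  assumes "e \<in> edges G" "c \<in> cuts G P e"
  shows "0 \<le> c" "c \<le> len G e"
  using assms wf P_points by (auto simp: cuts_def wf_wgraph_def points_def)

lemma fuse_proj_in: "x \<in> P \<Longrightarrow> \<pi> x = Vertex P"
  by (simp add: fuse_proj_def)

lemma fuse_proj_cut:
  assumes "e \<in> edges G" "c \<in> cuts G P e"
  shows "\<pi> (point_at G e c) = Vertex (if point_at G e c \<in> P then P else {point_at G e c})"
  using assms by (auto simp: fuse_proj_def cuts_def point_at_def)

lemma edges_fusion:
  "(e, a, b) \<in> edges F \<longleftrightarrow>
     e \<in> edges G \<and> a \<in> cuts G P e \<and> b \<in> cuts G P e \<and> a < b \<and>
     (\<forall>c\<in>cuts G P e. \<not> (a < c \<and> c < b))"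
  by (simp add: fusion_def identify_verts_def subdivide_def Let_def)

lemma verts_fusion:
  "verts F = (\<lambda>x. if x \<in> P then P else {x}) ` (Vertex ` verts G \<union> P)"
  by (simp add: fusion_def identify_verts_def subdivide_def Let_def)

lemma len_fusion: "len F (e, a, b) = b - a"
  by (simp add: fusion_def identify_verts_def subdivide_def Let_def)

text \<open>The dictionary between the two graphs, through which paths and functions are
  transferred. No cut lies strictly between \<open>a\<close> and \<open>b\<close>, so for an inner
  point the \<open>Max\<close> and \<open>Min\<close> in \<open>fuse_proj\<close> return exactly
  these two.\<close>

lemma point_at_fusion:
  assumes edge: "(e, a, b) \<in> edges F" and s: "0 \<le> s" "s \<le> b - a"
  shows "point_at F (e, a, b) s = \<pi> (point_at G e (a + s))"
proof -
  have e: "e \<in> edges G" and a: "a \<in> cuts G P e" and b: "b \<in> cuts G P e" and "a < b"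
    and consec: "\<And>c. c \<in> cuts G P e \<Longrightarrow> \<not> (a < c \<and> c < b)"
    using edge by (auto simp: edges_fusion)
  have ends: "end0 F (e, a, b) = (if point_at G e a \<in> P then P else {point_at G e a})"
    "end1 F (e, a, b) = (if point_at G e b \<in> P then P else {point_at G e b})"
    by (auto simp: fusion_def identify_verts_def subdivide_def Let_def)
  consider "s = 0" | "s = b - a" | "0 < s" "s < b - a" using s by linarith
  then show ?thesis
  proof cases
    case 1
    then show ?thesis using fuse_proj_cut[OF e a] by (simp add: point_at_def ends)
  next
    case 2
    then show ?thesis using fuse_proj_cut[OF e b] \<open>a < b\<close>
      by (simp add: point_at_def ends len_fusion)
  next
    case 3
    have "0 \<le> a" "b \<le> len G e" using cuts_bounds e a b by auto
    then have pt: "point_at G e (a + s) = Interior e (a + s)"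
      using 3 by (auto simp: point_at_def)
    have "a + s \<notin> cuts G P e" using consec[of "a + s"] 3 by auto
    then have notin: "Interior e (a + s) \<notin> P" by (auto simp: cuts_def)
    have fin: "finite (cuts G P e)" using finite_cuts[OF finite_P] .
    have "Max {c \<in> cuts G P e. c < a + s} = a"
      using fin a 3 consec by (intro Max_eqI) force+
    moreover have "Min {c \<in> cuts G P e. a + s < c} = b"
      using fin b 3 consec by (intro Min_eqI) force+
    ultimately show ?thesis
      using 3 notin pt by (simp add: fuse_proj_def point_at_def[of F] len_fusion)
  qed
qed

text \<open>Take the last cut up to \<open>s\<close> and the first cut from \<open>t\<close> on; the
  ends of \<open>e\<close> are cuts, so both exist, and \<open>s < t\<close> keeps them
  apart.\<close>

lemma consecutive_cuts:
  assumes e: "e \<in> edges G" and st: "0 \<le> s" "s < t" "t \<le> len G e"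
    and none: "\<forall>c\<in>cuts G P e. \<not> (s < c \<and> c < t)"
  obtains a b where "(e, a, b) \<in> edges F" "a \<le> s" "t \<le> b"
proof
  let ?A = "{c \<in> cuts G P e. c \<le> s}" and ?B = "{c \<in> cuts G P e. t \<le> c}"
  have fin: "finite ?A" "finite ?B" using finite_cuts[OF finite_P] by auto
  have ne: "?A \<noteq> {}" "?B \<noteq> {}" using st by (auto simp: cuts_def)
  have A: "Max ?A \<in> ?A" and B: "Min ?B \<in> ?B" using Max_in Min_in fin ne by blast+
  show "Max ?A \<le> s" "t \<le> Min ?B" using A B by auto
  have "\<not> (Max ?A < c \<and> c < Min ?B)" if "c \<in> cuts G P e" for c
  proof (cases "c \<le> s")
    case True
    then have "c \<le> Max ?A" using that fin by (intro Max_ge) auto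
    then show ?thesis by simp
  next
    case False
    then have "Min ?B \<le> c" using that fin none by (intro Min_le) auto
    then show ?thesis by simp
  qed
  moreover have "Max ?A < Min ?B" using A B st by auto
  ultimately show "(e, Max ?A, Min ?B) \<in> edges F" using A B e by (auto simp: edges_fusion)
qed

lemma interior_between_cuts:
  assumes "e \<in> edges G" "0 < t" "t < len G e" "Interior e t \<notin> P"
  obtains a b where "(e, a, b) \<in> edges F" "a < t" "t < b" "\<pi> (Interior e t) = Interior (e, a, b) (t - a)"
proof -
  let ?A = "{c \<in> cuts G P e. c < t}" and ?B = "{c \<in> cuts G P e. t < c}"
  have fin: "finite ?A" "finite ?B" using finite_cuts[OF finite_P] by auto
  have ne: "?A \<noteq> {}" "?B \<noteq> {}" using assms by (auto simp: cuts_def)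
  have A: "Max ?A \<in> ?A" and B: "Min ?B \<in> ?B" using Max_in Min_in fin ne by blast+
  have t: "t \<notin> cuts G P e" using assms by (auto simp: cuts_def)
  have "\<not> (Max ?A < c \<and> c < Min ?B)" if "c \<in> cuts G P e" for c
  proof (cases "c < t")
    case True
    then have "c \<le> Max ?A" using that fin by (intro Max_ge) auto
    then show ?thesis by simp
  next
    case False
    then have "Min ?B \<le> c" using that fin t by (intro Min_le) (auto simp: less_le)
    then show ?thesis by simp
  qed
  then have "(e, Max ?A, Min ?B) \<in> edges F" using A B assms(1) by (auto simp: edges_fusion)
  then show ?thesis using A B assms(4) by (intro that[of "Max ?A" "Min ?B"]) (auto simp: fuse_proj_def Let_def)
qed

lemma fuse_proj_image: "\<pi> ` points G = points F"
proof
  have "\<pi> x \<in> points F" if x: "x \<in> points G" for x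
  proof (cases "x \<in> P \<or> (\<exists>v. x = Vertex v)")
    case True
    then have "\<pi> x = Vertex (if x \<in> P then P else {x})" "x \<in> Vertex ` verts G \<union> P"
      using x by (auto simp: fuse_proj_def points_def)
    then show ?thesis
      unfolding points_def verts_fusion by blast
  next
    case False
    then obtain e t where et: "x = Interior e t" "e \<in> edges G" "0 < t" "t < len G e" "x \<notin> P"
      using x by (auto simp: points_def)
    obtain a b where "(e, a, b) \<in> edges F" "a < t" "t < b" "\<pi> x = Interior (e, a, b) (t - a)"
      using interior_between_cuts et by metis
    then show ?thesis unfolding points_def using len_fusion by auto
  qed
  then show "\<pi> ` points G \<subseteq> points F" by blast
  show "points F \<subseteq> \<pi> ` points G"
  proof
    fix X assume X: "X \<in> points F"
    show "X \<in> \<pi> ` points G"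
    proof (cases X)
      case (Vertex S)
      then obtain x where x: "x \<in> Vertex ` verts G \<union> P" "S = (if x \<in> P then P else {x})"
        using X unfolding points_def verts_fusion by blast
      then have "X = \<pi> x" using Vertex by (auto simp: fuse_proj_def)
      moreover have "x \<in> points G" using x P_points by (auto simp: points_def)
      ultimately show ?thesis by blast
    next
      case (Interior E s)
      obtain e a b where E: "E = (e, a, b)" by (cases E)
      have edge: "(e, a, b) \<in> edges F" and s: "0 < s" "s < b - a"
        using X Interior E by (auto simp: points_def len_fusion)
      have "X = \<pi> (point_at G e (a + s))"
        using point_at_fusion[OF edge, of s] s Interior E by (simp add: point_at_def len_fusion)
      moreover have "point_at G e (a + s) \<in> points G"
        using edge s cuts_bounds[of e a] cuts_bounds[of e b]
        by (intro point_at_in_points[OF wf]) (auto simp: edges_fusion)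
      ultimately show ?thesis by blast
    qed
  qed
qed

text \<open>Outside \<open>P\<close> nothing is lost: the image of \<open>Interior e t\<close> still
  carries \<open>e\<close>, \<open>a\<close> and \<open>t - a\<close>, from which \<open>t\<close>
  is recovered.\<close>

lemma fuse_proj_eqD:
  assumes "x \<in> points G" "y \<in> points G" "\<pi> x = \<pi> y"
  shows "x = y \<or> x \<in> P \<and> y \<in> P"
  using assms by (cases x; cases y) (auto simp: fuse_proj_def Let_def split: if_splits)

lemma path_length_fuse_proj_segment:
  assumes e: "e \<in> edges G" and st: "0 \<le> s" "s \<le> t" "t \<le> len G e"
  shows "path_length F (\<pi> (point_at G e s)) (\<pi> (point_at G e t)) (t - s)"
proof (rule interval_chain[OF finite_cuts[OF finite_P, of G e] _ _ st])
  fix s t assume st: "0 \<le> s" "s \<le> t" "t \<le> len G e"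
    and none: "\<forall>c\<in>cuts G P e. \<not> (s < c \<and> c < t)"
  show "path_length F (\<pi> (point_at G e s)) (\<pi> (point_at G e t)) (t - s)"
  proof (cases "s = t")
    case True
    then show ?thesis
      using fuse_proj_image point_at_in_points[OF wf e] st by (auto intro: path_length.trivial)
  next
    case False
    then obtain a b where ab: "(e, a, b) \<in> edges F" "a \<le> s" "t \<le> b"
      using consecutive_cuts[OF e] st none by (metis less_le)
    have "path_length F (point_at F (e, a, b) (s - a)) (point_at F (e, a, b) (t - a))
        \<bar>(s - a) - (t - a)\<bar>"
      using ab st by (intro path_length_segment[OF wf_F]) (auto simp: len_fusion)
    then show ?thesis using ab st by (simp add: point_at_fusion)
  qed
next
  fix s u t
  assume "path_length F (\<pi> (point_at G e s)) (\<pi> (point_at G e u)) (u - s)"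
    "path_length F (\<pi> (point_at G e u)) (\<pi> (point_at G e t)) (t - u)"
  from path_length_trans[OF this]
  show "path_length F (\<pi> (point_at G e s)) (\<pi> (point_at G e t)) (t - s)" by simp
qed

lemma path_length_fuse_proj:
  assumes "path_length G x y d"
  shows "path_length F (\<pi> x) (\<pi> y) d"
  using assms
proof (induction)
  case (trivial x)
  then show ?case using fuse_proj_image by (auto intro: path_length.trivial)
next
  case (segment e s t y d)
  have "path_length F (\<pi> (point_at G e s)) (\<pi> (point_at G e t)) \<bar>s - t\<bar>"
  proof (cases "s \<le> t")
    case True
    then show ?thesis using path_length_fuse_proj_segment[of e s t] segment by simp
  next
    case False
    then show ?thesis
      using path_length_sym[OF path_length_fuse_proj_segment[of e t s] wf_F] segment by simp
  qed
  then show ?case using path_length_trans segment.IH by blast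
qed

text \<open>A function constant on \<open>P\<close> descends to the quotient and stays 1-Lipschitz
  on each edge of the fusion, each of which is the image of a piece of an edge of
  \<open>G\<close>.\<close>

lemma path_length_fusion_ge:
  fixes g :: "('v, 'e) point \<Rightarrow> real"
  assumes path: "path_length F (\<pi> x) (\<pi> y) d" and xy: "x \<in> points G" "y \<in> points G"
    and lip: "\<And>e s t. \<lbrakk>e \<in> edges G; 0 \<le> s; s \<le> len G e; 0 \<le> t; t \<le> len G e\<rbrakk>
      \<Longrightarrow> \<bar>g (point_at G e s) - g (point_at G e t)\<bar> \<le> \<bar>s - t\<bar>"
    and const: "\<And>x y. \<lbrakk>x \<in> P; y \<in> P\<rbrakk> \<Longrightarrow> g x = g y"
  shows "\<bar>g x - g y\<bar> \<le> d"
proof -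
  \<comment> \<open>Any preimage may be chosen: two preimages of the same point differ only inside
    \<open>P\<close>, where \<open>g\<close> is constant.\<close>
  define f where "f = g \<circ> inv_into (points G) \<pi>"
  have f: "f (\<pi> x) = g x" if "x \<in> points G" for x
  proof -
    have "inv_into (points G) \<pi> (\<pi> x) \<in> points G" "\<pi> (inv_into (points G) \<pi> (\<pi> x)) = \<pi> x"
      using that by (auto intro: inv_into_into f_inv_into_f)
    then show ?thesis using fuse_proj_eqD[OF _ that] const by (metis comp_apply f_def)
  qed
  have "\<bar>f (point_at F E s) - f (point_at F E t)\<bar> \<le> \<bar>s - t\<bar>"
    if "E \<in> edges F" "0 \<le> s" "s \<le> len F E" "0 \<le> t" "t \<le> len F E" for E s t
  proof -
    obtain e a b where E: "E = (e, a, b)" by (cases E)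
    have edge: "(e, a, b) \<in> edges F" using that E by simp
    then have e: "e \<in> edges G" and "0 \<le> a" "b \<le> len G e"
      using cuts_bounds[of e a] cuts_bounds[of e b] by (auto simp: edges_fusion)
    with that E have b: "0 \<le> a + s" "a + s \<le> len G e" "0 \<le> a + t" "a + t \<le> len G e"
      by (auto simp: len_fusion)
    have "f (point_at F E s) = g (point_at G e (a + s))"
      "f (point_at F E t) = g (point_at G e (a + t))"
      using that E b by (auto simp: point_at_fusion len_fusion f point_at_in_points[OF wf e])
    then show ?thesis using lip[OF e b] by simp
  qed
  from path_length_lipschitz[OF path this] show ?thesis using f xy by simp
qed

end

subsection \<open>Arc-length parametrization of a cycle\<close>

locale cycle_graph =
  fixes G :: "('v, 'e) wgraph" and n :: nat and v :: "nat \<Rightarrow> 'v" and e :: "nat \<Rightarrow> 'e"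
  assumes wf: "wf_wgraph G" and n: "1 \<le> n"
    and bij_v: "bij_betw v {..<n} (verts G)" and bij_e: "bij_betw e {..<n} (edges G)"
    and ends: "\<And>i. i < n \<Longrightarrow> {end0 G (e i), end1 G (e i)} = {v i, v (Suc i mod n)}"
begin

definition "pos i = (\<Sum>j<i. len G (e j))"
text \<open>The stored order of the ends of \<open>e i\<close> may run against the cyclic order;
  reversing the coordinate in that case makes \<open>s\<close> the distance from \<open>v i\<close>
  along the edge. A loop satisfies the test and is run forwards.\<close>

definition "arc i s = point_at G (e i) (if end0 G (e i) = v i \<and> end1 G (e i) = v (Suc i mod n)
  then s else len G (e i) - s)"
text \<open>A vertex position below \<open>L\<close> is assigned to the edge that starts there, and
  \<open>L\<close> itself to the last edge, so that \<gamma> is also meaningful on the closed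
  interval up to \<open>L\<close>.\<close>

definition "idx x = Max {i. i < n \<and> pos i \<le> x}"
definition "\<gamma> x = arc (idx x) (x - pos (idx x))"

abbreviation "L \<equiv> total_length G"

lemma e_edge: "i < n \<Longrightarrow> e i \<in> edges G"
  using bij_e by (auto simp: bij_betw_def)

lemma len_pos: "i < n \<Longrightarrow> 0 < len G (e i)"
  using wf e_edge by (auto simp: wf_wgraph_def)

lemma pos_0: "pos 0 = 0" and pos_Suc: "pos (Suc i) = pos i + len G (e i)"
  by (simp_all add: pos_def)

lemma pos_n: "pos n = L"
  unfolding pos_def total_length_def using sum.reindex_bij_betw[OF bij_e] .

lemma pos_mono: "i \<le> j \<Longrightarrow> j \<le> n \<Longrightarrow> pos i \<le> pos j"
  unfolding pos_def using len_pos by (intro sum_mono2) (auto intro: less_imp_le)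

lemma pos_less: "i < j \<Longrightarrow> j \<le> n \<Longrightarrow> pos i < pos j"
  using pos_mono[of "Suc i" j] len_pos[of i] by (simp add: pos_Suc)

lemma pos_nonneg: "i \<le> n \<Longrightarrow> 0 \<le> pos i"
  using pos_mono[of 0 i] by (simp add: pos_0)

lemma L_pos: "0 < L"
  using pos_less[of 0 n] n by (simp add: pos_0 pos_n)

lemma arc_0: "i < n \<Longrightarrow> arc i 0 = Vertex (v i)"
  and arc_len: "i < n \<Longrightarrow> arc i (len G (e i)) = Vertex (v (Suc i mod n))"
  using ends[of i] len_pos[of i] by (auto simp: arc_def point_at_def doubleton_eq_iff)

lemma arc_interior:
  "0 < s \<Longrightarrow> s < len G (e i) \<Longrightarrow>
    arc i s = Interior (e i) (if end0 G (e i) = v i \<and> end1 G (e i) = v (Suc i mod n)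
      then s else len G (e i) - s)"
  by (auto simp: arc_def point_at_def)

lemma idx_eq:
  assumes "i < n" "pos i \<le> x" "x < pos (Suc i)"
  shows "idx x = i"
  unfolding idx_def
proof (rule Max_eqI)
  fix j assume "j \<in> {i. i < n \<and> pos i \<le> x}"
  then show "j \<le> i" using assms pos_mono[of "Suc i" j] by (auto simp: not_less_eq_eq[symmetric])
qed (use assms in auto)

lemma idx_bounds:
  assumes "0 \<le> x" "x < L"
  shows "idx x < n" "pos (idx x) \<le> x" "x < pos (Suc (idx x))"
proof -
  let ?I = "{i. i < n \<and> pos i \<le> x}"
  have "0 \<in> ?I" using assms n by (simp add: pos_0)
  then have "idx x \<in> ?I" unfolding idx_def by (intro Max_in) auto
  then show *: "idx x < n" "pos (idx x) \<le> x" by auto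
  show "x < pos (Suc (idx x))"
  proof (cases "Suc (idx x) < n")
    case True
    show ?thesis
    proof (rule ccontr)
      assume "\<not> x < pos (Suc (idx x))"
      then have "Suc (idx x) \<le> Max ?I" using True by (intro Max_ge) auto
      then show False by (simp add: idx_def)
    qed
  next
    case False
    then have "Suc (idx x) = n" using * by simp
    then show ?thesis using assms pos_n by simp
  qed
qed

text \<open>Only the right end needs an argument: there \<open>idx\<close> either moves on to the
  next edge, whose arc starts at the same vertex, or stays because \<open>i\<close> is the last
  edge.\<close>

lemma \<gamma>_arc:
  assumes "i < n" "pos i \<le> x" "x \<le> pos (Suc i)"
  shows "\<gamma> x = arc i (x - pos i)"
proof (cases "x < pos (Suc i)")
  case True
  then show ?thesis using idx_eq[OF assms(1,2)] by (simp add: \<gamma>_def)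
next
  case False
  then have x: "x = pos (Suc i)" using assms by simp
  show ?thesis
  proof (cases "Suc i < n")
    case True
    then have "idx x = Suc i" using x len_pos by (intro idx_eq) (auto simp: pos_Suc)
    then show ?thesis
      using True x arc_0[OF True] arc_len[of i] by (simp add: \<gamma>_def pos_Suc)
  next
    case False
    have "idx x = i" unfolding idx_def
      using False assms by (intro Max_eqI) auto
    then show ?thesis by (simp add: \<gamma>_def)
  qed
qed

lemma \<gamma>_L: "\<gamma> L = \<gamma> 0"
proof -
  obtain m where m: "n = Suc m" using n by (cases n) auto
  have L: "L = pos m + len G (e m)" using pos_n m by (simp add: pos_Suc)
  have "\<gamma> L = arc m (L - pos m)"
    using m pos_mono[of m n] pos_n by (intro \<gamma>_arc) (auto simp del: One_nat_def)
  also have "\<dots> = arc m (len G (e m))" using L by simp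
  also have "\<dots> = arc 0 0" using arc_len[of m] arc_0[of 0] m by simp
  also have "\<dots> = \<gamma> 0" using \<gamma>_arc[of 0 0] n pos_mono[of 0 1] by (simp add: pos_0)
  finally show ?thesis .
qed

lemma \<gamma>_cases:
  assumes "0 \<le> x" "x < L"
  obtains i where "i < n" "x = pos i" "\<gamma> x = Vertex (v i)"
  | i where "i < n" "pos i < x" "x < pos i + len G (e i)"
      "\<gamma> x = Interior (e i) (if end0 G (e i) = v i \<and> end1 G (e i) = v (Suc i mod n)
        then x - pos i else len G (e i) - (x - pos i))"
proof -
  note b = idx_bounds[OF assms]
  show ?thesis
  proof (cases "x = pos (idx x)")
    case True
    then show ?thesis using that(1)[of "idx x"] b arc_0 by (simp add: \<gamma>_def)
  next
    case False
    then show ?thesis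
      using that(2)[of "idx x"] b arc_interior[of "x - pos (idx x)" "idx x"]
      by (simp add: \<gamma>_def pos_Suc)
  qed
qed

lemma inj_\<gamma>: "inj_on \<gamma> {0..<L}"
proof (rule inj_onI)
  fix x y assume "x \<in> {0..<L}" "y \<in> {0..<L}" and eq: "\<gamma> x = \<gamma> y"
  then have x: "0 \<le> x" "x < L" and y: "0 \<le> y" "y < L" by auto
  have inj: "inj_on v {..<n}" "inj_on e {..<n}" using bij_v bij_e by (auto simp: bij_betw_def)
  from x show "x = y"
  proof (cases rule: \<gamma>_cases)
    case (1 i)
    from y show ?thesis
      by (cases rule: \<gamma>_cases) (use 1 eq inj in \<open>auto dest: inj_onD\<close>)
  next
    case i: (2 i)
    from y show ?thesis
    proof (cases rule: \<gamma>_cases)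
      case j: (2 j)
      have "e i = e j" using i j eq by simp
      then have "i = j" using inj(2) i(1) j(1) by (auto dest: inj_onD)
      then show ?thesis using i j eq by (simp split: if_splits)
    qed (use i eq in simp)
  qed
qed

lemma point_at_eq_\<gamma>:
  assumes "i < n" "0 \<le> s" "s \<le> len G (e i)"
  shows "point_at G (e i) s = \<gamma> (if end0 G (e i) = v i \<and> end1 G (e i) = v (Suc i mod n)
    then pos i + s else pos (Suc i) - s)"
  using assms by (simp add: \<gamma>_arc pos_Suc arc_def)

lemma \<gamma>_in_points:
  assumes "0 \<le> x" "x \<le> L"
  shows "\<gamma> x \<in> points G"
proof -
  have "\<gamma> x \<in> points G" if x: "0 \<le> x" "x < L" for x
    using x
    by (cases rule: \<gamma>_cases) (use bij_v e_edge in \<open>auto simp: points_def bij_betw_def\<close>)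
  then show ?thesis using assms \<gamma>_L L_pos by (cases "x = L") auto
qed

lemma \<gamma>_image: "\<gamma> ` {0..<L} = points G"
proof
  show "\<gamma> ` {0..<L} \<subseteq> points G" using \<gamma>_in_points by auto
  show "points G \<subseteq> \<gamma> ` {0..<L}"
  proof
    fix z assume z: "z \<in> points G"
    have "\<exists>x. 0 \<le> x \<and> x \<le> L \<and> \<gamma> x = z"
    proof (cases z)
      case (Vertex w)
      then obtain i where i: "i < n" "w = v i"
        using z bij_v by (auto simp: points_def bij_betw_def)
      then have "\<gamma> (pos i) = z"
        using \<gamma>_arc[of i "pos i"] arc_0 Vertex pos_mono[of i "Suc i"] by simp
      then show ?thesis using i pos_nonneg[of i] pos_mono[of i n] pos_n by auto
    next
      case (Interior f t)
      then obtain i where i: "i < n" "f = e i" and t: "0 < t" "t < len G (e i)"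
        using z bij_e by (force simp: points_def bij_betw_def)
      then have "z = point_at G (e i) t" using Interior by (simp add: point_at_def)
      also note point_at_eq_\<gamma>[OF i(1)]
      finally show ?thesis
        using t i pos_nonneg[of i] pos_mono[of "Suc i" n] pos_n
        by (intro exI[of _ "if end0 G (e i) = v i \<and> end1 G (e i) = v (Suc i mod n)
          then pos i + t else pos (Suc i) - t"]) (auto simp: pos_Suc)
    qed
    then show "z \<in> \<gamma> ` {0..<L}" using \<gamma>_L L_pos by (metis atLeastLessThan_iff imageI less_le order_refl)
  qed
qed

text \<open>Hides orientations: for a Lipschitz estimate it is enough that an edge is traversed by
  \<gamma> at unit speed, forwards or backwards.\<close>

lemma edge_\<gamma>:
  assumes "f \<in> edges G"
  obtains a where "0 \<le> a" "a + len G f \<le> L"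
    "(\<forall>s. 0 \<le> s \<and> s \<le> len G f \<longrightarrow> point_at G f s = \<gamma> (a + s)) \<or>
     (\<forall>s. 0 \<le> s \<and> s \<le> len G f \<longrightarrow> point_at G f s = \<gamma> (a + len G f - s))"
proof -
  obtain i where i: "i < n" "f = e i" using assms bij_e by (auto simp: bij_betw_def)
  show ?thesis
  proof (rule that[of "pos i"])
    show "0 \<le> pos i" "pos i + len G f \<le> L"
      using i pos_nonneg[of i] pos_mono[of "Suc i" n] by (auto simp: pos_Suc pos_n)
  qed (use i point_at_eq_\<gamma>[OF i(1)] in \<open>simp add: pos_Suc\<close>)
qed

lemma path_length_\<gamma>:
  assumes "0 \<le> s" "s \<le> t" "t \<le> L"
  shows "path_length G (\<gamma> s) (\<gamma> t) (t - s)"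
proof (rule interval_chain[of "pos ` {..n}" 0 L, OF _ _ _ assms])
  fix s t assume st: "0 \<le> s" "s \<le> t" "t \<le> L"
    and none: "\<forall>c\<in>pos ` {..n}. \<not> (s < c \<and> c < t)"
  show "path_length G (\<gamma> s) (\<gamma> t) (t - s)"
  proof (cases "s = t")
    case True
    then show ?thesis using st \<gamma>_in_points by (auto intro: path_length.trivial)
  next
    case False
    let ?i = "idx s"
    have i: "?i < n" "pos ?i \<le> s" "s < pos (Suc ?i)" using idx_bounds[of s] st False by auto
    \<comment> \<open>The end of the edge containing \<open>s\<close> is a break point beyond
      \<open>s\<close>, so it cannot lie before \<open>t\<close>.\<close>
    then have t: "t \<le> pos (Suc ?i)" using none by force
    let ?fwd = "end0 G (e ?i) = v ?i \<and> end1 G (e ?i) = v (Suc ?i mod n)"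
    let ?c = "\<lambda>x. if ?fwd then x - pos ?i else pos (Suc ?i) - x"
    have "path_length G (point_at G (e ?i) (?c s)) (point_at G (e ?i) (?c t)) \<bar>?c s - ?c t\<bar>"
      using i t st by (intro path_length_segment[OF wf e_edge]) (auto simp: pos_Suc)
    moreover have "point_at G (e ?i) (?c x) = \<gamma> x" if "pos ?i \<le> x" "x \<le> pos (Suc ?i)" for x
      using that i by (subst point_at_eq_\<gamma>) (auto simp: pos_Suc)
    moreover have "\<bar>?c s - ?c t\<bar> = t - s" using st by auto
    ultimately show ?thesis using i t st by simp
  qed
next
  fix s u t assume "path_length G (\<gamma> s) (\<gamma> u) (u - s)" "path_length G (\<gamma> u) (\<gamma> t) (t - u)"
  from path_length_trans[OF this] show "path_length G (\<gamma> s) (\<gamma> t) (t - s)" by simp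
qed auto

end

subsection \<open>Gaps between finitely many points\<close>

definition next_in :: "real set \<Rightarrow> real \<Rightarrow> real" where
  "next_in C c = Min {d \<in> C. c < d}"

lemma next_in_bounds:
  assumes "finite C" "u \<in> C" "c < u"
  shows "c < next_in C c" "next_in C c \<le> u"
proof -
  have "next_in C c \<in> {d \<in> C. c < d}"
    unfolding next_in_def using assms by (intro Min_in) auto
  then show "c < next_in C c" by auto
  show "next_in C c \<le> u" unfolding next_in_def using assms by (intro Min_le) auto
qed

text \<open>Telescoping, by adding the largest element \<open>b\<close> last: it contributes the gap
  \<open>u - b\<close>, and for the smaller elements \<open>b\<close> takes over the role of
  \<open>u\<close>.\<close>

lemma sum_gaps:
  assumes "finite C" "C \<noteq> {}" "\<And>c. c \<in> C \<Longrightarrow> c < u"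
  shows "(\<Sum>c\<in>C. next_in (insert u C) c - c) = u - Min C"
  using assms
proof (induction C arbitrary: u rule: finite_linorder_max_induct)
  case (insert b A)
  have "next_in (insert u (insert b A)) c = next_in (insert b A) c" if "c \<in> A" for c
  proof -
    let ?D = "{d \<in> insert b A. c < d}"
    have "b < u" "c < b" using insert that by auto
    then have eq: "{d \<in> insert u (insert b A). c < d} = insert u ?D" and "b \<in> ?D" by auto
    moreover have "Min ?D \<le> b" using \<open>finite A\<close> \<open>b \<in> ?D\<close> by (intro Min_le) auto
    moreover have "?D \<noteq> {}" "finite ?D" using \<open>finite A\<close> \<open>b \<in> ?D\<close> by auto
    ultimately show ?thesis
      using \<open>b < u\<close> unfolding next_in_def eq by (subst Min_insert) (auto simp: min_def)
  qed
  then have "(\<Sum>c\<in>A. next_in (insert u (insert b A)) c - c)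
      = (\<Sum>c\<in>A. next_in (insert b A) c - c)" by simp
  moreover have "next_in (insert u (insert b A)) b = u"
    unfolding next_in_def using insert by (intro Min_eqI) auto
  moreover have "b \<notin> A" using insert by auto
  ultimately have *: "(\<Sum>c\<in>insert b A. next_in (insert u (insert b A)) c - c)
      = (u - b) + (\<Sum>c\<in>A. next_in (insert b A) c - c)" using insert by simp
  show ?case
  proof (cases "A = {}")
    case False
    then have "Min (insert b A) = Min A"
      using insert Min_in[of A] by (simp add: min_def) fastforce
    then show ?thesis using * insert.IH[of b] insert.hyps False by simp
  qed (use * in simp)
qed simp

text \<open>Let \<open>c\<close> maximize \<open>l\<close> and \<open>d\<close> maximize it on the
  rest. With \<open>m = card C\<close>, the sum is at most \<open>l c + (m - 1) * l d\<close>, and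
  twice this falls short of \<open>m * (l c + l d)\<close> by \<open>(m - 2) * (l c - l d)\<close>,
  which is nonnegative.\<close>

lemma two_large_values:
  fixes l :: "'a \<Rightarrow> real"
  assumes "finite C" "2 \<le> card C"
  obtains c d where "c \<in> C" "d \<in> C" "c \<noteq> d" "2 * sum l C / card C \<le> l c + l d"
proof -
  have "C \<noteq> {}" using assms by auto
  then obtain c where c: "c \<in> C" "\<And>x. x \<in> C \<Longrightarrow> l x \<le> l c"
    using ex_is_arg_min_if_finite[of C "\<lambda>x. - l x"] assms(1) by (auto simp: is_arg_min_linorder)
  let ?D = "C - {c}"
  have "card ?D = card C - 1" using c by (simp add: card_Diff_singleton)
  then have "?D \<noteq> {}" using assms by force
  then obtain d where d: "d \<in> ?D" "\<And>x. x \<in> ?D \<Longrightarrow> l x \<le> l d"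
    using ex_is_arg_min_if_finite[of ?D "\<lambda>x. - l x"] assms(1)
    by (auto simp: is_arg_min_linorder)
  have "sum l C = l c + sum l ?D" using c assms(1) by (simp add: sum.remove)
  also have "sum l ?D \<le> real (card C - 1) * l d"
    using sum_bounded_above[of ?D l "l d"] d \<open>card ?D = _\<close> by simp
  finally have "2 * sum l C \<le> 2 * l c + 2 * ((real (card C) - 1) * l d)"
    using assms by (simp add: of_nat_diff)
  moreover have "0 \<le> (real (card C) - 2) * (l c - l d)" using assms c d by (intro mult_nonneg_nonneg) auto
  ultimately have "2 * sum l C \<le> (l c + l d) * card C" by (simp add: algebra_simps)
  then show ?thesis using that[of c d] c d assms(2) by (auto simp: divide_le_eq)
qed

section \<open>Tent functions on the real line\<close>

lemma bump_lipschitz: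
  "max 0 (r - \<bar>s - x\<bar>) - max 0 (r - \<bar>t - x\<bar>) \<le> \<bar>s - t\<bar>" for r s t x :: real
  by linarith

text \<open>The tents have disjoint supports. If \<open>s\<close> is under the first and
  \<open>t\<close> under the second, the distance \<open>y - x \<ge> a + b\<close> of the peaks
  forces \<open>\<bar>s - t\<bar>\<close> to be at least the sum of the two heights; otherwise the
  estimate for a single tent suffices.\<close>

lemma bump_diff_lipschitz:
  fixes x y a b s t :: real
  assumes "x + a \<le> y - b"
  defines "u \<equiv> \<lambda>t. max 0 (a - \<bar>t - x\<bar>) - max 0 (b - \<bar>t - y\<bar>)"
  shows "\<bar>u s - u t\<bar> \<le> \<bar>s - t\<bar>"
proof -
  define p where "p = (\<lambda>t. max 0 (a - \<bar>t - x\<bar>))"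
  define q where "q = (\<lambda>t. max 0 (b - \<bar>t - y\<bar>))"
  have nonneg: "0 \<le> p t" "0 \<le> q t" for t by (simp_all add: p_def q_def)
  have "u s - u t \<le> \<bar>s - t\<bar>" for s t
  proof (cases "0 < a - \<bar>s - x\<bar> \<and> 0 < b - \<bar>t - y\<bar>")
    case True
    then have "p s = a - \<bar>s - x\<bar>" "q t = b - \<bar>t - y\<bar>" by (simp_all add: p_def q_def)
    moreover have "u s - u t = p s - p t - q s + q t" by (simp add: u_def p_def q_def)
    moreover have "y - x \<le> \<bar>s - x\<bar> + \<bar>t - y\<bar> + \<bar>s - t\<bar>" by linarith
    ultimately show ?thesis using assms(1) nonneg[of t] nonneg[of s] by linarith
  next
    case False
    then have "p s = 0 \<or> q t = 0" unfolding p_def q_def by auto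
    moreover have "p s - p t \<le> \<bar>s - t\<bar>" "q t - q s \<le> \<bar>s - t\<bar>"
      using bump_lipschitz[of a s x t] bump_lipschitz[of b t y s]
      by (simp_all add: p_def q_def abs_minus_commute)
    moreover have "u s - u t = p s - p t - q s + q t" by (simp add: u_def p_def q_def)
    ultimately show ?thesis using nonneg[of t] nonneg[of s] by linarith
  qed
  from this[of s t] this[of t s] show ?thesis by (simp add: abs_le_iff abs_minus_commute)
qed

section \<open>Bounds for the diameter of a fused cycle\<close>

context cycle_graph
begin

text \<open>Both points travel to the fused vertex. Allowing \<open>c = L\<close> lets a point of
  the last gap move forwards to a fused point at coordinate \<open>0\<close>. With
  \<open>r = L\<close> this gives the crude bound that \<open>le_diam\<close> requires, with half
  the spacing the sharp one.\<close>

lemma fusion_paths: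
  assumes P: "P \<subseteq> points G" "finite P"
    and near: "\<And>t. \<lbrakk>0 \<le> t; t < L\<rbrakk> \<Longrightarrow> \<exists>c. 0 \<le> c \<and> c \<le> L \<and> \<gamma> c \<in> P \<and> \<bar>t - c\<bar> \<le> r"
    and XY: "X \<in> points (fusion G P)" "Y \<in> points (fusion G P)"
  shows "\<exists>d\<le>2 * r. path_length (fusion G P) X Y d"
proof -
  interpret pf: point_fusion G P using wf P by unfold_locales
  have *: "\<exists>d\<le>r. path_length (fusion G P) X (Vertex P) d" if "X \<in> points (fusion G P)" for X
  proof -
    have "X \<in> fuse_proj G P ` \<gamma> ` {0..<L}"
      using that by (simp add: \<gamma>_image pf.fuse_proj_image)
    then obtain t where t: "0 \<le> t" "t < L" "X = fuse_proj G P (\<gamma> t)" by auto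
    obtain c where c: "0 \<le> c" "c \<le> L" "\<gamma> c \<in> P" "\<bar>t - c\<bar> \<le> r" using near t by blast
    have "path_length G (\<gamma> t) (\<gamma> c) \<bar>t - c\<bar>"
    proof (cases "t \<le> c")
      case True
      then show ?thesis using path_length_\<gamma>[of t c] t c by simp
    next
      case False
      then show ?thesis using path_length_sym[OF path_length_\<gamma>[of c t] wf] t c by simp
    qed
    from pf.path_length_fuse_proj[OF this] show ?thesis
      using t c pf.fuse_proj_in by auto
  qed
  obtain d d' where d: "d \<le> r" "path_length (fusion G P) X (Vertex P) d"
    and d': "d' \<le> r" "path_length (fusion G P) Y (Vertex P) d'" using * XY by blast
  from path_length_trans[OF d(2) path_length_sym[OF d'(2) pf.wf_F]]
  show ?thesis using d(1) d'(1) by (intro exI[of _ "d + d'"]) auto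
qed

lemma fusion_diam_ge:
  assumes P: "P \<subseteq> points G" "card P = w + 1" and "1 \<le> w"
  shows "L / real (w + 1) \<le> diam (fusion G P)"
proof -
  have fin_P: "finite P" using P by (intro card_ge_0_finite) simp
  interpret pf: point_fusion G P using wf P fin_P by unfold_locales
  \<comment> \<open>The half-open interval gives each fused point exactly one coordinate, hence
    \<open>card C = w + 1\<close>.\<close>
  define C where "C = {t \<in> {0..<L}. \<gamma> t \<in> P}"
  have "inj_on \<gamma> C" using inj_\<gamma> by (rule inj_on_subset) (auto simp: C_def)
  moreover have C_image: "\<gamma> ` C = P" using P(1) \<gamma>_image by (force simp: C_def)
  ultimately have C: "finite C" "card C = w + 1" using P fin_P by (auto simp: finite_image_iff card_image)
  then have "C \<noteq> {}" by auto
  define c0 where "c0 = Min C"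
  have c0: "c0 \<in> C" "\<And>c. c \<in> C \<Longrightarrow> c0 \<le> c" using C \<open>C \<noteq> {}\<close> by (auto simp: c0_def)
  have C_bounds: "0 \<le> c" "c < L" if "c \<in> C" for c using that by (auto simp: C_def)
  then have c0_bounds: "0 \<le> c0" "c0 < L" using c0 by auto
  \<comment> \<open>The petals of the fusion are the gaps of \<open>C'\<close>; the last one wraps around \<open>L\<close>.\<close>
  define C' where "C' = insert (c0 + L) C"
  have "finite C'" using C by (simp add: C'_def)
  have C_less: "c < c0 + L" if "c \<in> C" for c using C_bounds[OF that] c0_bounds by simp
  have "(\<Sum>c\<in>C. next_in C' c - c) = L"
    using sum_gaps[of C "c0 + L"] C \<open>C \<noteq> {}\<close> C_less by (simp add: C'_def c0_def)
  then obtain c d where cd: "c \<in> C" "d \<in> C" "c \<noteq> d"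
    "2 * L / (w + 1) \<le> (next_in C' c - c) + (next_in C' d - d)"
    using two_large_values[of C "\<lambda>c. next_in C' c - c"] C \<open>1 \<le> w\<close> by auto
  \<comment> \<open>Ordering the two gaps puts the first one to the left of the second, which makes
    the two tents disjoint.\<close>
  obtain c d where cd: "c \<in> C" "d \<in> C" "c < d"
    "2 * L / (w + 1) \<le> (next_in C' c - c) + (next_in C' d - d)"
  proof (cases "c < d")
    case True
    then show ?thesis using that cd by blast
  next
    case False
    then show ?thesis using that[of d c] cd by auto
  qed
  \<comment> \<open>The tents are centred at the midpoints \<open>x\<close> and \<open>y\<close> of
    the gaps and have half the gap lengths as heights.\<close>
  define a where "a = (next_in C' c - c) / 2"
  define b where "b = (next_in C' d - d) / 2"
  define x where "x = c + a"
  define y where "y = d + b"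
  have nc: "c < next_in C' c" "next_in C' c \<le> d"
    using next_in_bounds[of C' d c] cd \<open>finite C'\<close> by (auto simp: C'_def)
  have nd: "d < next_in C' d" "next_in C' d \<le> c0 + L"
    using next_in_bounds[of C' "c0 + L" d] cd \<open>finite C'\<close> C_less by (auto simp: C'_def)
  have ab: "0 < a" "0 < b" "x + a \<le> y - b" "x - a = c" "y - b = d"
    "x + a = next_in C' c" "y + b = next_in C' d"
    using nc nd by (auto simp: a_def b_def x_def y_def field_simps)
  have xy: "c0 < x" "x < c0 + L" "c0 < y" "y < c0 + L"
    using ab c0(2)[OF cd(1)] c0(2)[OF cd(2)] nc nd by auto
  define u where "u = (\<lambda>t. max 0 (a - \<bar>t - x\<bar>) - max 0 (b - \<bar>t - y\<bar>))"
  have u_lip: "\<bar>u s - u t\<bar> \<le> \<bar>s - t\<bar>" for s t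
    unfolding u_def using bump_diff_lipschitz[of x a y b s t] ab by simp
  have u_zero: "u z = 0" if "z \<in> C'" for z
  proof -
    \<comment> \<open>No element of \<open>C'\<close> lies strictly inside a gap, so
      \<open>z\<close> is outside both open supports.\<close>
    have "z \<le> c \<or> next_in C' c \<le> z" "z \<le> d \<or> next_in C' d \<le> z"
      using next_in_bounds(2)[OF \<open>finite C'\<close> that] by force+
    then have "a \<le> \<bar>z - x\<bar>" "b \<le> \<bar>z - y\<bar>" using ab by auto
    then show ?thesis by (simp add: u_def)
  qed
  have u_xy: "u x = a" "u y = - b" using ab by (auto simp: u_def max_def)
  \<comment> \<open>\<open>u\<close> lives on one period starting at \<open>c0\<close>; moving the part beyond \<open>L\<close> back to the
    start keeps it Lipschitz because \<open>u\<close> vanishes at \<open>c0\<close> and \<open>c0 + L\<close>.\<close>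
  define U where "U = (\<lambda>t. if t \<le> c0 then u (t + L) else u t)"
  have u_c0: "u c0 = 0" "u (c0 + L) = 0" using u_zero c0 by (auto simp: C'_def)
  have U_lip: "\<bar>U s - U t\<bar> \<le> \<bar>s - t\<bar>" for s t
  proof -
    consider "s \<le> c0" "t \<le> c0" | "c0 < s" "c0 < t" | "s \<le> c0" "c0 < t" | "c0 < s" "t \<le> c0"
      by linarith
    then show ?thesis
    proof cases
      case 1
      then show ?thesis using u_lip[of "s + L" "t + L"] by (simp add: U_def)
    next
      case 2
      then show ?thesis using u_lip[of s t] by (simp add: U_def)
    next
      \<comment> \<open>Across the seam the two values are compared with the zeros at
        \<open>c0 + L\<close> and \<open>c0\<close>; the two distances add up to
        \<open>t - s\<close>.\<close>
      case 3
      then show ?thesis using u_lip[of "s + L" "c0 + L"] u_lip[of t c0] u_c0 by (simp add: U_def)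
    next
      case 4
      then show ?thesis using u_lip[of "t + L" "c0 + L"] u_lip[of s c0] u_c0 by (simp add: U_def)
    qed
  qed
  define g where "g = (\<lambda>z. U (inv_into {0..<L} \<gamma> z))"
  have g: "g (\<gamma> t) = U t" if "0 \<le> t" "t \<le> L" for t
  proof (cases "t = L")
    case True
    have "g (\<gamma> 0) = U 0" using inj_\<gamma> L_pos by (simp add: g_def inv_into_f_f)
    \<comment> \<open>Both sides are \<open>u L\<close>, because \<open>0 \<le> c0 < L\<close>; so
      \<open>U\<close> takes the same value at the two coordinates of the base point.\<close>
    also have "\<dots> = U L" using c0_bounds by (simp add: U_def)
    finally show ?thesis using True \<gamma>_L by simp
  next
    case False
    then show ?thesis using that inj_\<gamma> by (simp add: g_def inv_into_f_f)
  qed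
  have g_lip: "\<bar>g (point_at G f s) - g (point_at G f t)\<bar> \<le> \<bar>s - t\<bar>"
    if f: "f \<in> edges G" and st: "0 \<le> s" "s \<le> len G f" "0 \<le> t" "t \<le> len G f" for f s t
  proof -
    obtain p where p: "0 \<le> p" "p + len G f \<le> L"
      and or: "(\<forall>s. 0 \<le> s \<and> s \<le> len G f \<longrightarrow> point_at G f s = \<gamma> (p + s)) \<or>
           (\<forall>s. 0 \<le> s \<and> s \<le> len G f \<longrightarrow> point_at G f s = \<gamma> (p + len G f - s))"
      using edge_\<gamma>[OF f] by metis
    from or show ?thesis
    proof
      assume "\<forall>s. 0 \<le> s \<and> s \<le> len G f \<longrightarrow> point_at G f s = \<gamma> (p + s)"
      then show ?thesis using U_lip[of "p + s" "p + t"] st p by (simp add: g)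
    next
      assume "\<forall>s. 0 \<le> s \<and> s \<le> len G f \<longrightarrow> point_at G f s = \<gamma> (p + len G f - s)"
      then show ?thesis using U_lip[of "p + len G f - s" "p + len G f - t"] st p by (simp add: g)
    qed
  qed
  have g_zero: "g z = 0" if "z \<in> P" for z
  proof -
    obtain t where t: "t \<in> C" "z = \<gamma> t" using C_image \<open>z \<in> P\<close> by blast
    have "U t = 0"
      using c0(2)[OF t(1)] u_c0 u_zero[of t] t(1) by (auto simp: U_def C'_def)
    then show ?thesis using t C_bounds[OF t(1)] g by simp
  qed
  \<comment> \<open>The midpoint of the wrapping gap may lie beyond \<open>L\<close>; shifting it
    back by \<open>L\<close> lands below \<open>c0\<close>, where \<open>U\<close> undoes the
    shift.\<close>
  have attain: "\<exists>q \<in> points G. g q = u t" if "c0 < t" "t < c0 + L" for t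
  proof (cases "t \<le> L")
    case True
    then show ?thesis using that c0_bounds g[of t] \<gamma>_in_points[of t] by (auto simp: U_def)
  next
    case False
    then show ?thesis using that c0_bounds g[of "t - L"] \<gamma>_in_points[of "t - L"]
      by (intro bexI[of _ "\<gamma> (t - L)"]) (auto simp: U_def)
  qed
  obtain qx where qx: "qx \<in> points G" "g qx = a" using attain[of x] xy u_xy by auto
  obtain qy where qy: "qy \<in> points G" "g qy = - b" using attain[of y] xy u_xy by auto
  have "a + b \<le> diam (fusion G P)"
  proof (rule le_diam[OF pf.wf_F])
    show "fuse_proj G P qx \<in> points (fusion G P)" "fuse_proj G P qy \<in> points (fusion G P)"
      using qx qy pf.fuse_proj_image by auto
    show "\<exists>d\<le>2 * L. path_length (fusion G P) X Y d"
      if "X \<in> points (fusion G P)" "Y \<in> points (fusion G P)" for X Y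
    proof (rule fusion_paths[OF P(1) fin_P _ that])
      fix t assume "0 \<le> t" "t < L"
      then show "\<exists>c. 0 \<le> c \<and> c \<le> L \<and> \<gamma> c \<in> P \<and> \<bar>t - c\<bar> \<le> L"
        using c0(1) by (intro exI[of _ c0]) (auto simp: C_def)
    qed
    show "a + b \<le> d" if "path_length (fusion G P) (fuse_proj G P qx) (fuse_proj G P qy) d" for d
      using pf.path_length_fusion_ge[OF that qx(1) qy(1) g_lip] g_zero qx(2) qy(2) ab by simp
  qed
  moreover have "L / (w + 1) \<le> a + b" using cd(4) by (simp add: a_def b_def field_simps)
  ultimately show ?thesis by simp
qed

lemma fusion_diam_equidistant:
  obtains P where "P \<subseteq> points G" "card P = w + 1" "diam (fusion G P) \<le> L / real (w + 1)"
proof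
  define h where "h = L / real (w + 1)"
  have h: "0 < h" and L: "L = real (w + 1) * h" using L_pos by (auto simp: h_def)
  have less_L: "real k * h < L" if "k < w + 1" for k using that h unfolding L by simp
  let ?P = "(\<lambda>k. \<gamma> (real k * h)) ` {..<w + 1}"
  show P: "?P \<subseteq> points G" using \<gamma>_in_points less_L h by (auto simp: less_imp_le)
  have "inj_on (\<lambda>k. \<gamma> (real k * h)) {..<w + 1}"
  proof (rule inj_onI)
    fix j k assume jk: "j \<in> {..<w + 1}" "k \<in> {..<w + 1}" "\<gamma> (real j * h) = \<gamma> (real k * h)"
    then have "real j * h = real k * h"
      using less_L h by (intro inj_onD[OF inj_\<gamma> jk(3)]) auto
    then show "j = k" using h by simp
  qed
  then show "card ?P = w + 1" by (simp add: card_image)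
  have wf_F: "wf_wgraph (fusion G ?P)" using wf_wgraph_fusion[OF wf P] by simp
  interpret pf: point_fusion G ?P using wf P by unfold_locales auto
  have "diam (fusion G ?P) \<le> 2 * (h / 2)"
  proof (rule diam_le[OF wf_F])
    show "points (fusion G ?P) \<noteq> {}"
      using pf.fuse_proj_image \<gamma>_in_points[of 0] L_pos by auto
    fix X Y assume XY: "X \<in> points (fusion G ?P)" "Y \<in> points (fusion G ?P)"
    show "\<exists>d\<le>2 * (h / 2). path_length (fusion G ?P) X Y d"
    proof (rule fusion_paths[OF P _ _ XY])
      fix t assume t: "0 \<le> t" "t < L"
      \<comment> \<open>\<open>t\<close> lies in the \<open>k\<close>-th interval of length
        \<open>h\<close>, and the nearer end of that interval is within
        \<open>h / 2\<close>.\<close>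
      define k where "k = nat \<lfloor>t / h\<rfloor>"
      have "real k \<le> t / h" "t / h < real k + 1" using t h by (auto simp: k_def)
      then have k: "real k * h \<le> t" "t < real (Suc k) * h" using h by (auto simp: field_simps)
      have "real k * h < real (w + 1) * h" using k t L by simp
      then have kw: "k < w + 1" using h by simp
      then have le_L: "real (Suc k) * h \<le> L" using h unfolding L by (intro mult_right_mono) auto
      define p q where "p = real k * h" and "q = real (Suc k) * h"
      have "\<gamma> p \<in> ?P" unfolding p_def by (rule imageI) (use kw in simp)
      have "\<gamma> q \<in> ?P"
      proof (cases "Suc k < w + 1")
        case True
        then show ?thesis unfolding q_def by (intro imageI) simp
      next
        case False
        then have "Suc k = w + 1" using kw by simp
        \<comment> \<open>In the last interval the right end is the closing point of the cycle,
          which is the fused point with index \<open>0\<close>.\<close>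
        then have "q = L" using L by (simp add: q_def)
        then have "\<gamma> q = \<gamma> (real 0 * h)" using \<gamma>_L by simp
        moreover have "\<gamma> (real 0 * h) \<in> ?P" by (rule imageI) simp
        ultimately show ?thesis by simp
      qed
      have bounds: "0 \<le> p" "p \<le> L" "0 \<le> q" "q \<le> L"
        using h less_L[OF kw] le_L by (auto simp: p_def q_def)
      have "q = p + h" by (simp add: p_def q_def algebra_simps)
      then consider "\<bar>t - p\<bar> \<le> h / 2" | "\<bar>t - q\<bar> \<le> h / 2"
        using k unfolding p_def[symmetric] q_def[symmetric] by linarith
      then show "\<exists>c. 0 \<le> c \<and> c \<le> L \<and> \<gamma> c \<in> ?P \<and> \<bar>t - c\<bar> \<le> h / 2"
      proof cases
        case 1
        then show ?thesis using bounds \<open>\<gamma> p \<in> ?P\<close> by (intro exI[of _ p] conjI)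
      next
        case 2
        then show ?thesis using bounds \<open>\<gamma> q \<in> ?P\<close> by (intro exI[of _ q] conjI)
      qed
    qed simp
  qed
  also have "2 * (h / 2) = h" by simp
  also note h_def
  finally show "diam (fusion G ?P) \<le> L / real (w + 1)" .
qed

end

theorem mainTheorem8:
  fixes G :: "('v, 'e) wgraph" and L :: real and w :: nat
  assumes "wf_wgraph G" and "is_cycle G" and "total_length G = L" and "L > 0" and "w \<ge> 1"
  defines "D \<equiv> {diam (fusion G P) | P. P \<subseteq> points G \<and> card P = w + 1}"
  shows "L / real (w + 1) \<in> D \<and> (\<forall>d\<in>D. L / real (w + 1) \<le> d)"
proof -
  obtain n v e where "cycle_graph G n v e"
    using assms(1,2) unfolding is_cycle_def cycle_graph_def by blast
  then interpret cycle_graph G n v e .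
  have ge: "\<forall>d\<in>D. L / real (w + 1) \<le> d"
    using fusion_diam_ge assms(3,5) unfolding D_def by blast
  obtain P where P: "P \<subseteq> points G" "card P = w + 1" "diam (fusion G P) \<le> L / real (w + 1)"
    using fusion_diam_equidistant assms(3) by metis
  then have "diam (fusion G P) = L / real (w + 1)"
    using fusion_diam_ge[OF P(1,2)] assms(3,5) by simp
  then have "L / real (w + 1) \<in> D" unfolding D_def using P(1,2) by (intro CollectI exI[of _ P]) simp
  then show ?thesis using ge by blast
qed

end
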